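(* For each integer $n\ge 0$, let $d_n$ be the smallest positive integer such that $d_n \cdot (1^n + 2^n + \cdots + x^n)$ is a polynomial in $x$ with integer coefficients, let $q_n := d_n/(n+1)$ (an integer), and let $M_n := \frac{n+2}{2}$ if $n$ is even and $M_n := \frac{n+2}{3}$ if $n$ is odd. Then for any fixed $n \ge 0$, $$q_n = \prod_{p \le M_n} p^{\varepsilon_p},$$ the product over primes $p$, where $\varepsilon_p$ (depending on $n$) is defined as follows: $\varepsilon_2 = 0$ if $n = 2^r - 1$ for some $r \ge 0$, and $\varepsilon_2 = 1$ otherwise; and for an odd prime $p \le M_n$, $\varepsilon_p = 0$ if $p \nmid (n+2)$ and $p \mid \binom{n+1}{j(p-1)}$ for all $j = 2, 3, \ldots, \left\lfloor \frac{n}{p-1} \right\rfloor - 1$, and $\varepsilon_p = 1$ otherwise.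
   Context: Here $1^n+\cdots+x^n$ denotes the unique polynomial in $\mathbb{Q}[x]$ agreeing with this sum at all positive integers $x$. An empty product equals $1$. *)

theory Defs
  imports Complex_Main "HOL-Computational_Algebra.Primes" "HOL-Computational_Algebra.Polynomial"
begin

definition power_sum_poly :: "nat \<Rightarrow> rat poly" where
  "power_sum_poly n = (THE P. \<forall>x\<ge>1. poly P (of_nat x) = (\<Sum>k=1..x. of_nat k ^ n))"

lemma power_sum_poly_exists:
  "\<exists>P :: rat poly. \<forall>x. poly P (of_nat x) = (\<Sum>k=1..x. of_nat k ^ n)"
proof (induction n rule: less_induct)
  case (less n)
  have "\<forall>i. \<exists>P :: rat poly. i < n \<longrightarrow> (\<forall>x. poly P (of_nat x) = (\<Sum>k=1..x. of_nat k ^ i))"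
    using less by blast
  then obtain S :: "nat \<Rightarrow> rat poly"
    where S: "\<And>i x. i < n \<Longrightarrow> poly (S i) (of_nat x) = (\<Sum>k=1..x. of_nat k ^ i)"
    by metis
  define P where "P = smult (1 / of_nat (n + 1))
    ([:1, 1:] ^ (n + 1) - 1 - (\<Sum>i<n. smult (of_nat ((n + 1) choose i)) (S i)))"
  have tele: "(of_nat x + 1 :: rat) ^ (n + 1) - 1 =
      (\<Sum>i\<le>n. of_nat ((n + 1) choose i) * (\<Sum>k=1..x. of_nat k ^ i))" for x
  proof (induction x)
    case 0
    show ?case by simp
  next
    case (Suc x)
    have "(of_nat (Suc x) + 1 :: rat) ^ (n + 1) =
        (\<Sum>i\<le>n + 1. of_nat ((n + 1) choose i) * of_nat (Suc x) ^ i)"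
      by (subst binomial_ring) simp
    also have "\<dots> = (\<Sum>i\<le>n. of_nat ((n + 1) choose i) * of_nat (Suc x) ^ i) + of_nat (Suc x) ^ (n + 1)"
      by simp
    finally show ?case
      using Suc by (simp add: distrib_left sum.distrib add.commute)
  qed
  have "poly P (of_nat x) = (\<Sum>k=1..x. of_nat k ^ n)" for x
    using tele[of x] S[of _ x]
    by (simp add: P_def poly_sum lessThan_Suc_atMost[symmetric] field_simps)
  then show ?case by blast
qed

lemma power_sum_poly_ex1:
  "\<exists>!P :: rat poly. \<forall>x\<ge>1. poly P (of_nat x) = (\<Sum>k=1..x. of_nat k ^ n)"
proof -
  have "P = Q" if "\<forall>x\<ge>1. poly P (of_nat x) = (\<Sum>k=1..x. of_nat k ^ n)"
    and "\<forall>x\<ge>1. poly Q (of_nat x) = (\<Sum>k=1..x. of_nat k ^ n)" for P Q :: "rat poly"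
  proof (rule ccontr)
    assume "P \<noteq> Q"
    then have "finite {y. poly (P - Q) y = 0}"
      by (intro poly_roots_finite) simp
    moreover have "of_nat ` {1..} \<subseteq> {y. poly (P - Q) y = 0}"
      using that by auto
    ultimately have "finite (of_nat ` {1..} :: rat set)"
      by (rule rev_finite_subset)
    then show False
      by (simp add: finite_image_iff infinite_Ici)
  qed
  with power_sum_poly_exists[of n] show ?thesis by blast
qed

definition power_sum_denom :: "nat \<Rightarrow> nat" where
  "power_sum_denom n =
    (LEAST d. d > 0 \<and> (\<forall>i. coeff (smult (of_nat d) (power_sum_poly n)) i \<in> \<int>))"

lemma power_sum_denom_exists:
  "\<exists>d>0. \<forall>i. coeff (smult (of_nat d) (power_sum_poly n)) i \<in> \<int>"
proof -
  let ?P = "power_sum_poly n"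
  let ?b = "\<lambda>i. snd (quotient_of (coeff ?P i))"
  let ?d = "nat (\<Prod>i\<le>degree ?P. ?b i)"
  have pos: "(\<Prod>i\<le>degree ?P. ?b i) > 0"
    by (intro prod_pos) (simp add: quotient_of_denom_pos')
  have "coeff (smult (of_nat ?d) ?P) i \<in> \<int>" for i
  proof (cases "i \<le> degree ?P")
    case True
    then have "?b i dvd (\<Prod>i\<le>degree ?P. ?b i)"
      by (intro dvd_prodI) auto
    then obtain c where c: "(\<Prod>i\<le>degree ?P. ?b i) = ?b i * c" ..
    have q: "coeff ?P i = of_int (fst (quotient_of (coeff ?P i))) / of_int (?b i)"
      by (rule quotient_of_div) simp
    have b: "of_int (?b i) \<noteq> (0 :: rat)"
      using quotient_of_denom_pos'[of "coeff ?P i"] by simp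
    have "coeff (smult (of_nat ?d) ?P) i = of_int (?b i * c) * coeff ?P i"
      using pos by (simp add: c[symmetric] of_nat_nat)
    also have "\<dots> = of_int c * (of_int (?b i) * coeff ?P i)"
      by simp
    also have "of_int (?b i) * coeff ?P i = of_int (fst (quotient_of (coeff ?P i)))"
      using b by (subst (2) q) simp
    finally show ?thesis by simp
  next
    case False
    then show ?thesis by (simp add: coeff_eq_0)
  qed
  with pos show ?thesis by (intro exI[of _ ?d]) simp
qed

definition power_sum_quot :: "nat \<Rightarrow> rat" where
  "power_sum_quot n = of_nat (power_sum_denom n) / of_nat (n + 1)"

definition prime_bound :: "nat \<Rightarrow> rat" where
  "prime_bound n = (if even n then (of_nat n + 2) / 2 else (of_nat n + 2) / 3)"

definition prime_exponent :: "nat \<Rightarrow> nat \<Rightarrow> nat" where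
  "prime_exponent n p =
    (if p = 2 then (if \<exists>r::nat. n = 2 ^ r - 1 then 0 else 1)
     else (if \<not> p dvd n + 2 \<and> (\<forall>j\<in>{2..n div (p - 1) - 1}. p dvd ((n + 1) choose (j * (p - 1))))
           then 0 else 1))"

end

theory Submission imports "HOL-Number_Theory.Residues" Defs begin

text \<open>
  Let \<open>m = n + 1\<close>. The polynomial \<open>m (1\<^sup>n + \<dots> + x\<^sup>n)\<close> is monic with the coefficients
  \<open>(m choose k) B\<^sub>k\<close>, \<open>k < m\<close>, so \<open>q\<^sub>n\<close> is the common denominator of these numbers, and by von
  Staudt--Clausen an odd prime \<open>p\<close> divides it, exactly once, iff \<open>p\<close> does not divide
  \<open>m choose j (p - 1)\<close> for some \<open>j\<close> with \<open>0 < j (p - 1) < m\<close>. By Hermite's congruence the sum of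
  all these binomial coefficients is divisible by \<open>p\<close>, so no single one of them can be the only one
  prime to \<open>p\<close>. This allows the largest \<open>j\<close> to be dropped from the criterion, and it forces
  \<open>p \<le> M\<^sub>n\<close>. The index \<open>j = 1\<close> gives the condition on \<open>n + 2\<close>, because \<open>p\<close> divides
  \<open>m choose (p - 1)\<close> iff it does not divide \<open>m + 1\<close>.
\<close>

section \<open>The coefficients of the power sum polynomials\<close>

lemma poly_eqI_of_nat:
  fixes P Q :: "'a::{idom,ring_char_0} poly"
  assumes "\<And>x::nat. poly P (of_nat x) = poly Q (of_nat x)"
  shows "P = Q"
proof (rule ccontr)
  assume "P \<noteq> Q"
  then have "finite {y. poly (P - Q) y = 0}"
    by (intro poly_roots_finite) simp
  moreover have "range of_nat \<subseteq> {y. poly (P - Q) y = 0}"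
    using assms by auto
  ultimately have "finite (range of_nat :: 'a set)"
    by (rule rev_finite_subset)
  then show False
    by (simp add: finite_image_iff inj_on_def)
qed

text \<open>The definition fixes the values only at positive integers. The constructed polynomial
  also matches the empty sum at 0, and uniqueness transfers this.\<close>

lemma poly_power_sum_poly: "poly (power_sum_poly n) (of_nat x) = (\<Sum>k=1..x. of_nat k ^ n)"
proof -
  obtain P :: "rat poly" where P: "\<And>x. poly P (of_nat x) = (\<Sum>k=1..x. of_nat k ^ n)"
    using power_sum_poly_exists by blast
  have "power_sum_poly n = P"
    unfolding power_sum_poly_def by (rule the1_equality[OF power_sum_poly_ex1]) (simp add: P)
  with P show ?thesis by simp
qed

lemma power_sum_poly_0: "power_sum_poly 0 = [:0, 1:]"
  by (rule poly_eqI_of_nat) (simp add: poly_power_sum_poly)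

lemma coeff_0_power_sum_poly: "coeff (power_sum_poly n) 0 = 0"
  using poly_power_sum_poly[of n 0] by (simp add: poly_0_coeff_0)

lemma power_sum_poly_shift:
  "pcompose (power_sum_poly n) [:1, 1:] = power_sum_poly n + [:1, 1:] ^ n"
proof (rule poly_eqI_of_nat)
  fix x :: nat
  have "poly (pcompose (power_sum_poly n) [:1, 1:]) (of_nat x) = poly (power_sum_poly n) (of_nat (Suc x))"
    by (simp add: poly_pcompose add.commute)
  also have "\<dots> = poly (power_sum_poly n + [:1, 1:] ^ n) (of_nat x)"
    unfolding poly_power_sum_poly poly_add by (simp add: poly_power)
  finally show "poly (pcompose (power_sum_poly n) [:1, 1:]) (of_nat x) = \<dots>" .
qed

text \<open>The sum runs up to \<open>x\<close>, not \<open>x - 1\<close>, so this is the convention \<open>B\<^sub>1 = 1/2\<close>.\<close>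
definition bernoulli_num :: "nat \<Rightarrow> rat" where
  "bernoulli_num n = coeff (power_sum_poly n) 1"

text \<open>Differentiating the shift equation shows that the derivative and \<open>Suc n\<close>
  times \<open>power_sum_poly n\<close> have the same forward differences, so they differ by a
  constant, read off at 0.\<close>

lemma pderiv_power_sum_poly:
  "pderiv (power_sum_poly (Suc n)) = smult (of_nat (Suc n)) (power_sum_poly n) + [:bernoulli_num (Suc n):]"
proof (rule poly_eqI_of_nat)
  fix x :: nat
  let ?D = "pderiv (power_sum_poly (Suc n))"
  have "pderiv (pcompose (power_sum_poly (Suc n)) [:1, 1:]) = pcompose ?D [:1, 1:]"
    by (simp add: pderiv_pcompose pderiv_pCons)
  then have shift: "pcompose ?D [:1, 1:] = ?D + smult (of_nat (Suc n)) ([:1, 1:] ^ n)"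
    by (simp add: power_sum_poly_shift pderiv_add pderiv_power_Suc pderiv_pCons del: power_Suc)
  have step: "poly ?D (of_nat (Suc x)) = poly ?D (of_nat x) + of_nat (Suc n) * of_nat (Suc x) ^ n" for x
    using arg_cong[OF shift, of "\<lambda>P. poly P (of_nat x)"] by (simp add: poly_pcompose poly_power add.commute)
  show "poly ?D (of_nat x) =
      poly (smult (of_nat (Suc n)) (power_sum_poly n) + [:bernoulli_num (Suc n):]) (of_nat x)"
  proof (induction x)
    case 0
    show ?case
      by (simp add: poly_0_coeff_0 coeff_0_power_sum_poly bernoulli_num_def coeff_pderiv)
  next
    case (Suc x)
    then show ?case
      unfolding step poly_add poly_smult poly_power_sum_poly by (simp add: distrib_left)
  qed
qed

text \<open>Comparing coefficients in the derivative relation lowers \<open>n\<close> and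
  \<open>j\<close> together until the linear coefficient, a Bernoulli number, is reached.\<close>

lemma coeff_Suc_power_sum_poly:
  "coeff (power_sum_poly n) (Suc j) = of_nat (n choose j) / of_nat (Suc j) * bernoulli_num (n - j)"
proof (induction n arbitrary: j)
  case 0
  show ?case
    by (cases j) (simp_all add: power_sum_poly_0 bernoulli_num_def)
next
  case (Suc n)
  show ?case
  proof (cases j)
    case 0
    then show ?thesis by (simp add: bernoulli_num_def)
  next
    case (Suc i)
    have "of_nat (Suc (Suc i)) * coeff (power_sum_poly (Suc n)) (Suc (Suc i)) =
        of_nat (Suc n) * coeff (power_sum_poly n) (Suc i)"
      using arg_cong[OF pderiv_power_sum_poly[of n], of "\<lambda>P. coeff P (Suc i)"]
      by (simp add: coeff_pderiv)
    also have "\<dots> = of_nat (Suc n * (n choose i)) / of_nat (Suc i) * bernoulli_num (n - i)"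
      unfolding Suc.IH by (simp add: algebra_simps)
    also have "\<dots> = of_nat (Suc n choose Suc i) * bernoulli_num (n - i)"
      unfolding Suc_times_binomial_eq[of n i] by (simp del: of_nat_Suc binomial_Suc_Suc mult_Suc_right)
    finally show ?thesis
      unfolding Suc by (simp add: field_simps del: of_nat_Suc)
  qed
qed

lemma coeff_Suc_power_sum_poly':
  assumes "k \<le> n"
  shows "of_nat (Suc n) * coeff (power_sum_poly n) (Suc n - k) = of_nat (Suc n choose k) * bernoulli_num k"
proof -
  have "of_nat (Suc n) * coeff (power_sum_poly n) (Suc (n - k)) =
      of_nat (Suc n * (n choose (n - k))) / of_nat (Suc (n - k)) * bernoulli_num k"
    unfolding coeff_Suc_power_sum_poly using assms by (simp add: algebra_simps)
  also have "\<dots> = of_nat (Suc n choose Suc (n - k)) * bernoulli_num k"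
    unfolding Suc_times_binomial_eq by (simp del: of_nat_Suc binomial_Suc_Suc mult_Suc_right)
  also have "Suc n choose Suc (n - k) = Suc n choose k"
    using binomial_symmetric[of k "Suc n"] assms by (simp add: Suc_diff_le)
  finally show ?thesis using assms by (simp add: Suc_diff_le)
qed

lemma coeff_power_sum_poly_eq_0:
  assumes "j = 0 \<or> j > Suc n"
  shows "coeff (power_sum_poly n) j = 0"
proof (cases j)
  case (Suc i)
  then show ?thesis using assms by (simp add: coeff_Suc_power_sum_poly)
qed (simp add: coeff_0_power_sum_poly)

lemma bernoulli_num_0: "bernoulli_num 0 = 1"
  by (simp add: bernoulli_num_def power_sum_poly_0)

text \<open>Faulhaber's formula, grouped so that at \<open>x = p\<close> each factor
  \<open>p ^ (t + 1) / (t + 1)\<close> can be estimated by itself.\<close>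

lemma power_sum_eq_bernoulli_num:
  "(\<Sum>k=1..x. of_nat k ^ n) =
    (\<Sum>i\<le>n. of_nat (n choose i) * bernoulli_num i * (of_nat x ^ Suc (n - i) / of_nat (Suc (n - i))))"
proof -
  have "(\<Sum>k=1..x. of_nat k ^ n) = poly (power_sum_poly n) (of_nat x)"
    by (simp add: poly_power_sum_poly)
  also have "\<dots> = (\<Sum>i\<le>Suc n. coeff (power_sum_poly n) i * of_nat x ^ i)"
    unfolding poly_altdef
    by (intro sum.mono_neutral_left) (auto simp: coeff_eq_0 intro!: degree_le coeff_power_sum_poly_eq_0)
  also have "\<dots> = (\<Sum>j\<le>n. coeff (power_sum_poly n) (Suc j) * of_nat x ^ Suc j)"
    by (subst sum.atMost_Suc_shift) (simp add: coeff_0_power_sum_poly)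
  also have "\<dots> = (\<Sum>i\<le>n. coeff (power_sum_poly n) (Suc (n - i)) * of_nat x ^ Suc (n - i))"
    by (rule sum.nat_diff_reindex[symmetric, where n = "Suc n", simplified lessThan_Suc_atMost, simplified])
  also have "\<dots> = (\<Sum>i\<le>n. of_nat (n choose i) * bernoulli_num i * (of_nat x ^ Suc (n - i) / of_nat (Suc (n - i))))"
    by (rule sum.cong) (simp_all add: coeff_Suc_power_sum_poly binomial_symmetric[symmetric])
  finally show ?thesis .
qed

section \<open>Rational numbers integral at a prime\<close>

text \<open>For prime \<open>p\<close>, the localization of the integers at \<open>p\<close> as a
  subring of the rationals. The condition on \<open>b\<close> also excludes 0.\<close>

definition local_ints :: "nat \<Rightarrow> rat set" where
  "local_ints p = {of_int a / of_int b | a b. \<not> int p dvd b}"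

lemma Ints_subset_local_ints: "prime p \<Longrightarrow> \<int> \<subseteq> local_ints p"
proof
  fix x :: rat assume p: "prime p" and "x \<in> \<int>"
  then obtain a where a: "x = of_int a" by (elim Ints_cases)
  have "\<not> int p dvd 1" using p not_prime_unit by auto
  then show "x \<in> local_ints p" unfolding a local_ints_def
    by (intro CollectI exI[of _ a] exI[of _ 1]) auto
qed

lemma local_ints_add:
  assumes "prime p" "x \<in> local_ints p" "y \<in> local_ints p"
  shows "x + y \<in> local_ints p"
proof -
  obtain a b c d where x: "x = of_int a / of_int b" "\<not> int p dvd b"
    and y: "y = of_int c / of_int d" "\<not> int p dvd d"
    using assms by (auto simp: local_ints_def)
  have "b \<noteq> 0" "d \<noteq> 0" using x y by auto
  then have "x + y = of_int (a * d + c * b) / of_int (b * d)"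
    by (simp add: x y field_simps)
  moreover have "\<not> int p dvd b * d"
    using assms(1) x y by (simp add: prime_dvd_mult_iff)
  ultimately show ?thesis unfolding local_ints_def by blast
qed

lemma local_ints_mult:
  assumes "prime p" "x \<in> local_ints p" "y \<in> local_ints p"
  shows "x * y \<in> local_ints p"
proof -
  obtain a b c d where x: "x = of_int a / of_int b" "\<not> int p dvd b"
    and y: "y = of_int c / of_int d" "\<not> int p dvd d"
    using assms by (auto simp: local_ints_def)
  have "x * y = of_int (a * c) / of_int (b * d)"
    by (simp add: x y)
  moreover have "\<not> int p dvd b * d"
    using assms(1) x y by (simp add: prime_dvd_mult_iff)
  ultimately show ?thesis unfolding local_ints_def by blast
qed

lemma local_ints_of_nat: "prime p \<Longrightarrow> of_nat k \<in> local_ints p"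
  by (meson Ints_of_nat Ints_subset_local_ints subsetD)

lemma local_ints_minus:
  assumes "x \<in> local_ints p" shows "- x \<in> local_ints p"
proof -
  obtain a b where x: "x = of_int a / of_int b" "\<not> int p dvd b"
    using assms by (auto simp: local_ints_def)
  then have "- x = of_int (- a) / of_int b" by simp
  with x(2) show ?thesis unfolding local_ints_def by blast
qed

lemma local_ints_diff:
  "prime p \<Longrightarrow> x \<in> local_ints p \<Longrightarrow> y \<in> local_ints p \<Longrightarrow> x - y \<in> local_ints p"
  using local_ints_add[of p x "- y"] local_ints_minus by simp

lemma local_ints_sum:
  assumes "prime p" "\<And>i. i \<in> A \<Longrightarrow> f i \<in> local_ints p"
  shows "sum f A \<in> local_ints p"
  using assms(2)
proof (induction A rule: infinite_finite_induct)
  case (insert i A)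
  then show ?case using assms(1) by (simp add: local_ints_add)
qed (use Ints_subset_local_ints[OF assms(1)] in auto)

lemma of_nat_divide_in_local_ints_iff:
  assumes "prime p"
  shows "of_nat a / of_nat p \<in> local_ints p \<longleftrightarrow> p dvd a"
proof
  assume "of_nat a / of_nat p \<in> local_ints p"
  then obtain c d where cd: "of_nat a / of_nat p = (of_int c / of_int d :: rat)" "\<not> int p dvd d"
    by (auto simp: local_ints_def)
  have "d \<noteq> 0" "p \<noteq> 0" using cd assms by auto
  then have "of_int (int a * d) = (of_int (c * int p) :: rat)"
    using cd by (simp add: field_simps)
  then have "int a * d = c * int p"
    by (simp only: of_int_eq_iff)
  then have "int p dvd int a * d" by simp
  then show "p dvd a"
    using cd assms by (simp add: prime_dvd_mult_iff)
next
  assume "p dvd a"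
  then obtain b where "a = p * b" ..
  then show "of_nat a / of_nat p \<in> local_ints p"
    using assms local_ints_of_nat[of p b] by simp
qed

lemma inverse_of_nat_in_local_ints:
  assumes "\<not> p dvd u"
  shows "inverse (of_nat u) \<in> local_ints p"
proof -
  have "inverse (of_nat u) = (of_int 1 / of_int (int u) :: rat)" by (simp add: field_simps)
  moreover have "\<not> int p dvd int u" using assms by simp
  ultimately show ?thesis unfolding local_ints_def by blast
qed

text \<open>A prime factor of the reduced denominator would obstruct integrality at that prime, so
  integrality can be tested one prime at a time.\<close>

lemma Ints_iff_local_ints:
  "x \<in> \<int> \<longleftrightarrow> (\<forall>p. prime p \<longrightarrow> x \<in> local_ints p)"
proof
  assume *: "\<forall>p. prime p \<longrightarrow> x \<in> local_ints p"
  obtain a b where ab: "quotient_of x = (a, b)" by (cases "quotient_of x")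
  have x: "x = of_int a / of_int b" and b: "b > 0" and cop: "coprime a b"
    using ab quotient_of_div quotient_of_denom_pos quotient_of_coprime by auto
  have "is_unit b"
  proof (rule ccontr)
    assume "\<not> is_unit b"
    then obtain q where q: "prime q" "q dvd b"
      using b by (metis prime_divisor_exists less_numeral_extra(3))
    define p where "p = nat q"
    have p: "prime p" and qp: "q = int p"
      using q(1) prime_gt_0_int[OF q(1)] by (simp_all only: p_def prime_int_nat_transfer)
    obtain c d where cd: "x = of_int c / of_int d" "\<not> int p dvd d"
      using * p by (auto simp: local_ints_def)
    have "d \<noteq> 0" using cd by auto
    then have "of_int (a * d) = (of_int (c * b) :: rat)"
      using cd x b by (simp add: field_simps)
    then have "a * d = c * b" by (simp only: of_int_eq_iff)
    then have "q dvd a * d" using q(2) by simp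
    then have "q dvd a" using cd q(1) qp by (simp add: prime_dvd_mult_iff)
    then show False using cop q by (meson coprime_common_divisor not_prime_unit)
  qed
  then have "b = 1" using b by simp
  then show "x \<in> \<int>" using x by simp
qed (use Ints_subset_local_ints in auto)

section \<open>The von Staudt--Clausen theorem\<close>

text \<open>With \<open>Suc t = p ^ v * u\<close> and \<open>u\<close> prime to \<open>p\<close>,
  the claims amount to \<open>v \<le> t\<close> and \<open>v < t\<close>. They follow from
  \<open>p ^ v \<le> t + 1 \<le> 2 ^ t \<le> p ^ t\<close>, where \<open>t + 1 < p ^ t\<close> under
  the extra conditions of the second claim.\<close>

lemma prime_power_divide_Suc_in_local_ints:
  assumes p: "prime p"
  shows "of_nat p ^ t / of_nat (Suc t) \<in> local_ints p" (is ?A)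
    and "t > 0 \<Longrightarrow> p \<noteq> 2 \<or> t \<noteq> 1 \<Longrightarrow> of_nat p ^ (t - 1) / of_nat (Suc t) \<in> local_ints p" (is "_ \<Longrightarrow> _ \<Longrightarrow> ?B")
proof -
  obtain v u where vu: "Suc t = p ^ v * u" "\<not> p dvd u"
    using prime_power_canonical[OF p, of "Suc t"] by (metis mult.commute zero_less_Suc)
  have p2: "p \<ge> 2" using p by (rule prime_ge_2_nat)
  have pv: "p ^ v \<le> Suc t" using vu by (cases u) auto
  have key: "of_nat p ^ s / of_nat (Suc t) \<in> local_ints p" if vs: "v \<le> s" for s
  proof -
    obtain w where "s = v + w" using vs le_Suc_ex by blast
    then have "of_nat p ^ s / of_nat (Suc t) = (of_nat (p ^ w) * inverse (of_nat u) :: rat)"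
      unfolding vu using p2 by (simp add: power_add divide_inverse)
    then show ?thesis
      using local_ints_mult[OF p local_ints_of_nat[OF p] inverse_of_nat_in_local_ints[OF vu(2)]]
      by (simp only:)
  qed
  have 2: "Suc t \<le> 2 ^ t" by (induction t) auto
  also have "\<dots> \<le> p ^ t" using p2 by (rule power_mono) simp
  finally have pt: "Suc t \<le> p ^ t" .
  then have "p ^ v \<le> p ^ t" using pv by simp
  then have vt: "v \<le> t" using p2 by simp
  then show ?A by (rule key)
  assume t: "t > 0" and ne: "p \<noteq> 2 \<or> t \<noteq> 1"
  have "Suc t < p ^ t"
  proof (cases "p = 2")
    case True
    with ne t have "t \<ge> 2" by simp
    then have "Suc t < 2 ^ t"
      by (induction t rule: dec_induct) auto
    with True show ?thesis by simp
  next
    case False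
    with p2 have "2 < p" by simp
    then have "2 ^ t < p ^ t" using t by (intro power_strict_mono) auto
    with 2 show ?thesis by linarith
  qed
  then have "p ^ v < p ^ t" using pv by simp
  then have "v < t" using p2 by simp
  then show ?B by (intro key) simp
qed

text \<open>Evaluate the power sum polynomial at \<open>p\<close>. Apart from \<open>p B\<^sub>n\<close>, its terms are
  \<open>(n choose i) (p B\<^sub>i) p\<^sup>t / (t + 1)\<close> with \<open>t = n - i \<ge> 1\<close>, and \<open>p\<^sup>t / (t + 1)\<close> is
  divisible by \<open>p\<close> except when \<open>p = 2\<close> and \<open>t = 1\<close>.\<close>

lemma prime_times_bernoulli_num_in_local_ints:
  assumes p: "prime p"
  shows "of_nat p * bernoulli_num n \<in> local_ints p"
proof (induction n rule: less_induct)
  case (less n)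
  let ?f = "\<lambda>i. of_nat (n choose i) * bernoulli_num i * (of_nat p ^ Suc (n - i) / of_nat (Suc (n - i)))"
  have "(\<Sum>k=1..p. of_nat k ^ n) = (\<Sum>i<n. ?f i) + of_nat p * bernoulli_num n"
    unfolding power_sum_eq_bernoulli_num by (simp flip: lessThan_Suc_atMost)
  then have eq: "of_nat p * bernoulli_num n = of_nat (\<Sum>k=1..p. k ^ n) - (\<Sum>i<n. ?f i)"
    by simp
  have "?f i \<in> local_ints p" if "i < n" for i
  proof -
    have "?f i = of_nat (n choose i) * (of_nat p * bernoulli_num i)
        * (of_nat p ^ (n - i) / of_nat (Suc (n - i)))" by simp
    then show ?thesis
      by (simp only:) (intro local_ints_mult p local_ints_of_nat less that
          prime_power_divide_Suc_in_local_ints(1))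
  qed
  then show ?case unfolding eq
    by (intro local_ints_diff p local_ints_of_nat local_ints_sum) auto
qed

text \<open>In Faulhaber's formula at \<open>p\<close>, divided by \<open>p\<close>, every term
  besides \<open>bernoulli_num n\<close> is integral at \<open>p\<close>. For \<open>p = 2\<close>
  and odd \<open>n > 1\<close> this fails: the Bernoulli number is 0, but \<open>1 + 2 ^ n\<close>
  is odd.\<close>

theorem von_staudt_clausen:
  assumes p: "prime p" and n: "p \<noteq> 2 \<or> even n \<or> n = 1"
  shows "bernoulli_num n - of_nat (\<Sum>k=1..p. k ^ n) / of_nat p \<in> local_ints p"
proof -
  let ?g = "\<lambda>i. of_nat (n choose i) * bernoulli_num i * (of_nat p ^ (n - i) / of_nat (Suc (n - i)))"
  have p0: "p > 0" using p by (rule prime_gt_0_nat)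
  have "(\<Sum>k=1..p. of_nat k ^ n) = of_nat p * (\<Sum>i\<le>n. ?g i)"
    unfolding power_sum_eq_bernoulli_num sum_distrib_left by (rule sum.cong) simp_all
  then have "of_nat (\<Sum>k=1..p. k ^ n) / of_nat p = (\<Sum>i<n. ?g i) + bernoulli_num n"
    using p0 by (simp flip: lessThan_Suc_atMost)
  then have eq: "bernoulli_num n - of_nat (\<Sum>k=1..p. k ^ n) / of_nat p = - (\<Sum>i<n. ?g i)"
    by simp
  have "?g i \<in> local_ints p" if i: "i < n" for i
  proof (cases "p = 2 \<and> n - i = 1")
    case False
    have "?g i = of_nat (n choose i) * (of_nat p * bernoulli_num i)
        * (of_nat p ^ (n - i - 1) / of_nat (Suc (n - i)))"
      using i by (cases "n - i") auto
    then show ?thesis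
      by (simp only:) (intro local_ints_mult p local_ints_of_nat
          prime_times_bernoulli_num_in_local_ints prime_power_divide_Suc_in_local_ints(2);
          use False i in auto)
  next
    case True
    then have n': "n = Suc i" by linarith
    \<comment> \<open>The factor \<open>2 ^ 1 / 2\<close> is 1. What remains is harmless if
      \<open>n = 1\<close>; otherwise the even \<open>n\<close> supplies the 2 that clears the
      denominator.\<close>
    have g: "?g i = of_nat (Suc i) * bernoulli_num i" using True n' by simp
    show ?thesis
    proof (cases "n = 1")
      case True
      then show ?thesis using n' g p local_ints_of_nat[of p 1] by (simp add: bernoulli_num_0)
    next
      case False
      with n True obtain l where "n = 2 * l" by auto
      then have "?g i = of_nat l * (of_nat p * bernoulli_num i)" using g n' True
        by (metis mult.assoc mult.commute of_nat_mult)
      then show ?thesis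
        by (simp only:) (intro local_ints_mult p local_ints_of_nat
          prime_times_bernoulli_num_in_local_ints)
    qed
  qed
  then show ?thesis unfolding eq
    by (intro local_ints_minus local_ints_sum p) auto
qed

section \<open>Power sums and binomial coefficients modulo a prime\<close>

text \<open>Telescoping of \<open>(a + 1) ^ m - a ^ m\<close> over \<open>a < x\<close>, with
  \<open>0 ^ 0 = 1\<close> in the inner sums.\<close>

lemma sum_binomial_power_sum:
  fixes x :: nat
  assumes "m > 0"
  shows "(\<Sum>k<m. (m choose k) * (\<Sum>a<x. a ^ k)) = x ^ m"
proof (induction x)
  case 0
  then show ?case using assms by simp
next
  case (Suc x)
  have "Suc x ^ m = (\<Sum>k\<le>m. (m choose k) * x ^ k)"
    using binomial[of x 1 m] by simp
  also have "\<dots> = (\<Sum>k<m. (m choose k) * x ^ k) + x ^ m"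
    by (simp flip: lessThan_Suc_atMost)
  finally show ?case using Suc by (simp add: distrib_left sum.distrib)
qed

text \<open>In the telescoped identity for exponent \<open>k + 1\<close> at \<open>x = p\<close>,
  everything except \<open>(k + 1)\<close> times the wanted sum is divisible by \<open>p\<close> by
  induction, and \<open>k + 1 < p\<close>.\<close>

lemma prime_dvd_power_sum_less:
  fixes p k :: nat
  assumes p: "prime p" and "k < p - 1"
  shows "p dvd (\<Sum>a<p. a ^ k)"
  using assms(2)
proof (induction k rule: less_induct)
  case (less k)
  have "p dvd p ^ Suc k" by simp
  also have "p ^ Suc k = (\<Sum>i<k. (Suc k choose i) * (\<Sum>a<p. a ^ i)) + Suc k * (\<Sum>a<p. a ^ k)"
    using sum_binomial_power_sum[of "Suc k" p] by simp
  finally have "p dvd (\<Sum>i<k. (Suc k choose i) * (\<Sum>a<p. a ^ i)) + Suc k * (\<Sum>a<p. a ^ k)" .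
  moreover have "p dvd (\<Sum>i<k. (Suc k choose i) * (\<Sum>a<p. a ^ i))"
    by (rule dvd_sum, rule dvd_mult, rule less.IH) (use less.prems in auto)
  ultimately have "p dvd Suc k * (\<Sum>a<p. a ^ k)"
    by (simp only: dvd_add_right_iff)
  moreover have "\<not> p dvd Suc k"
    using less.prems by (auto dest: dvd_imp_le)
  ultimately show ?case using p by (simp only: prime_dvd_mult_iff) simp
qed

text \<open>By Fermat, each nonzero \<open>a\<close> contributes 1 if \<open>p - 1\<close> divides
  \<open>k\<close>; otherwise the exponent may be reduced modulo \<open>p - 1\<close> to the
  preceding case. For \<open>k = 0\<close> the term \<open>0 ^ 0 = 1\<close> makes the sum equal to
  \<open>p\<close>.\<close>

lemma power_sum_cong:
  fixes p k :: nat
  assumes p: "prime p"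
  shows "[int (\<Sum>a<p. a ^ k) = (if k > 0 \<and> (p - 1) dvd k then - 1 else 0)] (mod int p)"
proof (cases "k > 0 \<and> (p - 1) dvd k")
  case True
  then obtain l where l: "k = (p - 1) * l" by auto
  have "[a ^ k = 1] (mod p)" if "a \<in> {1..<p}" for a
  proof -
    have "\<not> p dvd a" using that by (auto dest: dvd_imp_le)
    then have "[a ^ (p - 1) = 1] (mod p)" using p by (intro fermat_theorem)
    then show ?thesis using cong_pow[of "a ^ (p - 1)" 1 p l] by (simp add: l power_mult)
  qed
  then have "[(\<Sum>a\<in>{1..<p}. a ^ k) = (\<Sum>a\<in>{1..<p}. 1)] (mod p)"
    by (rule cong_sum)
  moreover have "(\<Sum>a<p. a ^ k) = (\<Sum>a\<in>{1..<p}. a ^ k)"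
    using True by (intro sum.mono_neutral_right) auto
  ultimately have "[(\<Sum>a<p. a ^ k) = p - 1] (mod p)" by simp
  then have "[int (\<Sum>a<p. a ^ k) = int (p - 1)] (mod int p)"
    by (simp only: cong_int_iff)
  also have "[int (p - 1) = - 1] (mod int p)"
    using prime_gt_0_nat[OF p] by (simp add: of_nat_diff cong_iff_dvd_diff)
  finally show ?thesis using True by simp
next
  case False
  have "p dvd (\<Sum>a<p. a ^ k)"
  proof (cases "k = 0")
    case True
    then show ?thesis by simp
  next
    case k: False
    let ?r = "k mod (p - 1)" and ?l = "k div (p - 1)"
    \<comment> \<open>Positivity of the remainder keeps the reduction valid at \<open>a = 0\<close>,
      where both powers vanish.\<close>
    have r: "?r > 0" using False k by (auto simp: dvd_eq_mod_eq_0)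
    have p1: "p - 1 > 0" using prime_gt_1_nat[OF p] by simp
    have "[a ^ k = a ^ ?r] (mod p)" if "a < p" for a
    proof (cases "a = 0")
      case True
      then show ?thesis using r k by (simp add: power_0_left)
    next
      case a: False
      have "\<not> p dvd a" using that a by (auto dest: dvd_imp_le)
      then have "[a ^ (p - 1) = 1] (mod p)" using p by (intro fermat_theorem)
      then have "[(a ^ (p - 1)) ^ ?l * a ^ ?r = 1 ^ ?l * a ^ ?r] (mod p)"
        by (intro cong_mult cong_pow) auto
      then show ?thesis by (simp flip: power_mult power_add)
    qed
    then have "[(\<Sum>a<p. a ^ k) = (\<Sum>a<p. a ^ ?r)] (mod p)"
      by (intro cong_sum) auto
    moreover have "p dvd (\<Sum>a<p. a ^ ?r)"
      using p p1 by (intro prime_dvd_power_sum_less) auto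
    ultimately show ?thesis using cong_dvd_iff by blast
  qed
  then have "int p dvd int (\<Sum>a<p. a ^ k)" by (simp only: of_nat_dvd_iff)
  then show ?thesis unfolding if_not_P[OF False] cong_0_iff .
qed

lemma prime_dvd_power_sum_iff:
  assumes p: "prime p" and "k > 0"
  shows "p dvd (\<Sum>a=1..p. a ^ k) \<longleftrightarrow> \<not> (p - 1) dvd k"
proof -
  have "(\<Sum>a=1..p. a ^ k) = (\<Sum>a\<le>p. a ^ k)"
    using assms by (intro sum.mono_neutral_left) auto
  also have "\<dots> = (\<Sum>a<p. a ^ k) + p ^ k"
    by (simp flip: lessThan_Suc_atMost)
  finally have "p dvd (\<Sum>a=1..p. a ^ k) \<longleftrightarrow> p dvd (\<Sum>a<p. a ^ k)"
    using assms by (simp add: dvd_add_left_iff)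
  also have "\<dots> \<longleftrightarrow> int p dvd int (\<Sum>a<p. a ^ k)"
    by (simp only: of_nat_dvd_iff)
  also have "\<dots> \<longleftrightarrow> int p dvd (if k > 0 \<and> (p - 1) dvd k then - 1 else 0)"
    by (rule cong_dvd_iff[OF power_sum_cong[OF p]])
  also have "\<dots> \<longleftrightarrow> \<not> (p - 1) dvd k"
    using assms not_prime_unit[of p] by auto
  finally show ?thesis .
qed

text \<open>Hermite's congruence: take \<open>x = p\<close> in \<open>sum_binomial_power_sum\<close>
  and replace each inner power sum by its residue -1 or 0.\<close>

lemma prime_dvd_sum_binomial:
  assumes p: "prime p" and m: "m > 0"
  shows "p dvd (\<Sum>k | 0 < k \<and> k < m \<and> (p - 1) dvd k. m choose k)"
proof -
  let ?K = "{k. 0 < k \<and> k < m \<and> (p - 1) dvd k}"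
  have "[\<Sum>k<m. int (m choose k) * int (\<Sum>a<p. a ^ k) =
      (\<Sum>k<m. int (m choose k) * (if k > 0 \<and> (p - 1) dvd k then - 1 else 0))] (mod int p)"
    by (intro cong_sum cong_mult cong_refl power_sum_cong p)
  also have "(\<Sum>k<m. int (m choose k) * (if k > 0 \<and> (p - 1) dvd k then - 1 else 0)) =
      (\<Sum>k\<in>?K. - int (m choose k))"
    by (rule sum.mono_neutral_cong_right) auto
  also have "\<dots> = - int (\<Sum>k\<in>?K. m choose k)"
    by (simp add: sum_negf)
  also have "(\<Sum>k<m. int (m choose k) * int (\<Sum>a<p. a ^ k)) = int (p ^ m)"
    unfolding sum_binomial_power_sum[OF m, symmetric] by simp
  finally have "int p dvd int (p ^ m) \<longleftrightarrow> int p dvd - int (\<Sum>k\<in>?K. m choose k)"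
    by (rule cong_dvd_iff)
  then show ?thesis
    using m by (simp only: dvd_minus_iff of_nat_dvd_iff) simp
qed

text \<open>If \<open>p\<close> divided all other terms of Hermite's sum, it would divide this one
  too.\<close>

lemma exists_other_binomial_not_dvd:
  assumes p: "prime p" and k: "0 < k" "k < m" "(p - 1) dvd k" "\<not> p dvd (m choose k)"
  obtains k' where "k' \<noteq> k" "0 < k'" "k' < m" "(p - 1) dvd k'" "\<not> p dvd (m choose k')"
proof (rule ccontr)
  assume "\<not> thesis"
  with that have *: "p dvd (m choose k')" if "k' \<noteq> k" "0 < k'" "k' < m" "(p - 1) dvd k'" for k'
    using that by blast
  let ?K = "{k. 0 < k \<and> k < m \<and> (p - 1) dvd k}"
  have "finite ?K" by simp
  then have "(\<Sum>k\<in>?K. m choose k) = (m choose k) + (\<Sum>k\<in>?K - {k}. m choose k)"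
    using k by (intro sum.remove) auto
  moreover have "p dvd (\<Sum>k\<in>?K. m choose k)"
    using k by (intro prime_dvd_sum_binomial p) auto
  moreover have "p dvd (\<Sum>k\<in>?K - {k}. m choose k)"
    using * by (intro dvd_sum) auto
  ultimately have "p dvd (m choose k)" by (simp only: dvd_add_left_iff)
  with k(4) show False ..
qed

text \<open>Absorption gives \<open>p ^ e dvd j * (m choose j)\<close>. Were the binomial prime to
  \<open>p\<close>, then \<open>p ^ e\<close> would divide the smaller positive number
  \<open>j\<close>.\<close>

lemma prime_dvd_binomial:
  fixes p e m j :: nat
  assumes p: "prime p" and "p ^ e dvd m" "0 < j" "j < p ^ e"
  shows "p dvd (m choose j)"
proof (rule ccontr)
  assume "\<not> p dvd (m choose j)"
  then have "coprime (p ^ e) (m choose j)"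
    using p by (simp add: prime_imp_coprime)
  moreover have "p ^ e dvd j * (m choose j)"
    using assms times_binomial_minus1_eq[of j m] by simp
  ultimately have "p ^ e dvd j"
    by (simp add: coprime_dvd_mult_left_iff)
  then show False using assms by (auto dest: dvd_imp_le)
qed

text \<open>By Pascal's rule, neighbouring entries of row \<open>m\<close> sum to an entry of row
  \<open>m + 1\<close> that is divisible by \<open>p\<close>, so they only change sign modulo
  \<open>p\<close>, starting from 1.\<close>

lemma prime_not_dvd_binomial:
  fixes p e m j :: nat
  assumes p: "prime p" and "p ^ e dvd Suc m" and "j < p ^ e"
  shows "\<not> p dvd (m choose j)"
  using assms(3)
proof (induction j)
  case 0
  then show ?case using p not_prime_unit by auto
next
  case (Suc j)
  have "p dvd (Suc m choose Suc j)"
    using assms Suc.prems by (intro prime_dvd_binomial) auto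
  moreover have "\<not> p dvd (m choose j)"
    using Suc by simp
  ultimately show ?case by (metis binomial_Suc_Suc dvd_add_left_iff)
qed

text \<open>One direction is the preceding lemma with \<open>e = 1\<close>; the other follows from
  \<open>Suc m * (m choose (p - 1)) = p * (Suc m choose p)\<close>.\<close>

lemma prime_dvd_binomial_pred_iff:
  assumes p: "prime p"
  shows "p dvd (m choose (p - 1)) \<longleftrightarrow> \<not> p dvd Suc m"
proof
  assume "p dvd (m choose (p - 1))"
  then show "\<not> p dvd Suc m"
    using prime_not_dvd_binomial[OF p, of 1 m "p - 1"] prime_gt_0_nat[OF p] by auto
next
  assume "\<not> p dvd Suc m"
  moreover have "p dvd Suc m * (m choose (p - 1))"
    using Suc_times_binomial_eq[of m "p - 1"] prime_gt_0_nat[OF p] by simp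
  ultimately show "p dvd (m choose (p - 1))"
    using p by (simp only: prime_dvd_mult_iff) simp
qed

section \<open>The primes dividing the quotient\<close>

text \<open>The quotient is the product of these primes because \<open>(m choose k) B\<^sub>k\<close> has
  \<open>p\<close> at most once in its denominator.\<close>
definition denom_prime :: "nat \<Rightarrow> nat \<Rightarrow> bool" where
  "denom_prime m p \<longleftrightarrow> prime p \<and> (\<exists>k<m. of_nat (m choose k) * bernoulli_num k \<notin> local_ints p)"

text \<open>Up to a number integral at \<open>p\<close>, the Bernoulli number is the power sum
  divided by \<open>p\<close>, so the question becomes whether \<open>p\<close> divides
  \<open>c\<close> times that sum.\<close>

lemma binomial_bernoulli_num_in_local_ints_iff:
  assumes p: "prime p" and k: "k > 0" "p \<noteq> 2 \<or> even k \<or> k = 1"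
  shows "of_nat c * bernoulli_num k \<in> local_ints p \<longleftrightarrow> p dvd c \<or> \<not> (p - 1) dvd k"
proof -
  let ?S = "\<Sum>a=1..p. a ^ k"
  have *: "of_nat c * (bernoulli_num k - of_nat ?S / of_nat p) \<in> local_ints p"
    by (intro local_ints_mult p local_ints_of_nat von_staudt_clausen k)
  have eq: "of_nat c * bernoulli_num k =
      of_nat c * (bernoulli_num k - of_nat ?S / of_nat p) + of_nat (c * ?S) / of_nat p"
    by (simp add: algebra_simps)
  then have eq': "of_nat (c * ?S) / of_nat p =
      of_nat c * bernoulli_num k - of_nat c * (bernoulli_num k - of_nat ?S / of_nat p)"
    by simp
  have "of_nat c * bernoulli_num k \<in> local_ints p \<longleftrightarrow> of_nat (c * ?S) / of_nat p \<in> local_ints p"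
    using local_ints_add[OF p *] local_ints_diff[OF p _ *] eq eq' by metis
  also have "\<dots> \<longleftrightarrow> p dvd c * ?S"
    by (rule of_nat_divide_in_local_ints_iff[OF p])
  also have "\<dots> \<longleftrightarrow> p dvd c \<or> \<not> (p - 1) dvd k"
    using prime_dvd_power_sum_iff[OF p k(1)] p by (simp only: prime_dvd_mult_iff)
  finally show ?thesis .
qed

lemma denom_prime_odd_iff:
  assumes p: "prime p" "p \<noteq> 2"
  shows "denom_prime m p \<longleftrightarrow> (\<exists>k. 0 < k \<and> k < m \<and> (p - 1) dvd k \<and> \<not> p dvd (m choose k))"
proof -
  have "of_nat (m choose k) * bernoulli_num k \<notin> local_ints p \<longleftrightarrow>
      0 < k \<and> (p - 1) dvd k \<and> \<not> p dvd (m choose k)" for k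
  proof (cases "k = 0")
    case True
    then show ?thesis using local_ints_of_nat[OF p(1), of 1] by (simp add: bernoulli_num_0)
  next
    case False
    then show ?thesis using binomial_bernoulli_num_in_local_ints_iff[of p k "m choose k"] p by auto
  qed
  then show ?thesis using p by (auto simp: denom_prime_def)
qed

text \<open>For \<open>m = 2 ^ r\<close> all inner binomials are even, which clears the single 2 in
  the denominators. Otherwise the witness is \<open>k = 2 ^ e\<close>, the exact power of 2 in
  \<open>m\<close>; it is 1 or even, as von Staudt-Clausen requires.\<close>

lemma denom_prime_2_iff:
  assumes "m > 0"
  shows "denom_prime m 2 \<longleftrightarrow> (\<nexists>r. m = 2 ^ r)"
proof
  assume bad: "denom_prime m 2"
  show "\<nexists>r. m = 2 ^ r"
  proof
    assume "\<exists>r. m = 2 ^ r"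
    then obtain r where r: "m = 2 ^ r" ..
    obtain k where k: "k < m" "of_nat (m choose k) * bernoulli_num k \<notin> local_ints 2"
      using bad by (auto simp: denom_prime_def)
    have "k \<noteq> 0"
    proof
      assume "k = 0"
      then show False
        using k local_ints_of_nat[OF two_is_prime_nat, of 1] by (simp add: bernoulli_num_0)
    qed
    then have "2 dvd (m choose k)"
      using k r by (intro prime_dvd_binomial[of 2 r]) auto
    then obtain c where "m choose k = 2 * c" ..
    then have "of_nat (m choose k) * bernoulli_num k = of_nat c * (of_nat 2 * bernoulli_num k)"
      by simp
    then show False
      using k local_ints_mult[OF two_is_prime_nat local_ints_of_nat[OF two_is_prime_nat]
          prime_times_bernoulli_num_in_local_ints[OF two_is_prime_nat]] by metis
  qed
next
  assume npow: "\<nexists>r. m = 2 ^ r"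
  obtain e u where eu: "m = 2 ^ e * u" "\<not> 2 dvd u"
    using prime_power_canonical[OF two_is_prime_nat assms] by (metis mult.commute)
  have "u \<noteq> 1" using npow eu(1) by auto
  moreover have "u \<noteq> 0" using eu(2) by (metis dvd_0_right)
  ultimately have lt: "2 ^ e < m" using eu(1) by simp
  \<comment> \<open>Absorption cancels \<open>2 ^ e\<close> and leaves two odd factors, the second
    because \<open>2 ^ e\<close> divides \<open>Suc (m - 1)\<close>.\<close>
  have "2 ^ e * (m choose 2 ^ e) = 2 ^ e * (u * (m - 1 choose (2 ^ e - 1)))"
    using times_binomial_minus1_eq[of "2 ^ e" m] eu by simp
  then have "m choose 2 ^ e = u * (m - 1 choose (2 ^ e - 1))"
    by simp
  moreover have "\<not> 2 dvd (m - 1 choose (2 ^ e - 1))"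
    using assms eu by (intro prime_not_dvd_binomial[of 2 e]) auto
  ultimately have odd: "\<not> 2 dvd (m choose 2 ^ e)"
    using eu by simp
  have "of_nat (m choose 2 ^ e) * bernoulli_num (2 ^ e) \<notin> local_ints 2"
    using odd by (subst binomial_bernoulli_num_in_local_ints_iff) auto
  then show "denom_prime m 2"
    using lt by (auto simp: denom_prime_def)
qed

lemma prime_bound_ge_iff:
  "of_nat p \<le> prime_bound n \<longleftrightarrow> (if even n then 2 * p \<le> n + 2 else 3 * p \<le> n + 2)"
proof -
  have "(of_nat p \<le> (of_nat n + 2) / (2 :: rat)) \<longleftrightarrow> of_nat (2 * p) \<le> (of_nat (n + 2) :: rat)"
    and "(of_nat p \<le> (of_nat n + 2) / (3 :: rat)) \<longleftrightarrow> of_nat (3 * p) \<le> (of_nat (n + 2) :: rat)"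
    by (simp_all add: field_simps)
  then show ?thesis unfolding prime_bound_def of_nat_le_iff by simp
qed

text \<open>For odd \<open>p\<close>, Hermite yields two distinct indices, so one is at least
  \<open>2 * (p - 1)\<close>, whence \<open>2 * p \<le> n + 2\<close>. If \<open>n\<close> is odd
  and \<open>3 * p > n + 2\<close>, then \<open>n + 2\<close> lies strictly between
  \<open>2 * p\<close> and \<open>3 * p\<close>; this rules out the index \<open>p - 1\<close> and
  leaves only one candidate for both.\<close>

lemma denom_prime_le_prime_bound:
  assumes bad: "denom_prime (Suc n) p"
  shows "of_nat p \<le> prime_bound n"
proof -
  have p: "prime p" using bad by (simp add: denom_prime_def)
  show ?thesis
  proof (cases "p = 2")
    case True
    have "\<not> (\<exists>r. Suc n = 2 ^ r)"
      using bad denom_prime_2_iff[of "Suc n"] True by simp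
    \<comment> \<open>These are exactly the \<open>n\<close> for which 2 exceeds the bound.\<close>
    moreover have "Suc 0 = 2 ^ 0" "Suc 1 = 2 ^ 1" "Suc 3 = 2 ^ 2" by simp_all
    ultimately have "n \<noteq> 0" "n \<noteq> 1" "n \<noteq> 3" by metis+
    then show ?thesis unfolding prime_bound_ge_iff using True by (auto elim!: oddE)
  next
    case False
    have p3: "p \<ge> 3" "odd p" using p False prime_ge_2_nat[OF p] prime_odd_nat[OF p] by auto
    obtain k where k: "0 < k" "k < Suc n" "(p - 1) dvd k" "\<not> p dvd (Suc n choose k)"
      using bad denom_prime_odd_iff[OF p False] by auto
    obtain k' where k': "k' \<noteq> k" "0 < k'" "k' < Suc n" "(p - 1) dvd k'" "\<not> p dvd (Suc n choose k')"
      using exists_other_binomial_not_dvd[OF p k] .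
    have "\<exists>k. p - 1 < k \<and> k < Suc n \<and> (p - 1) dvd k \<and> \<not> p dvd (Suc n choose k)"
      using k k' by (metis dvd_imp_le le_neq_implies_less)
    then obtain l where l: "p - 1 < l" "l < Suc n" "(p - 1) dvd l" "\<not> p dvd (Suc n choose l)"
      by blast
    obtain i where i: "l = (p - 1) * i" using l(3) ..
    have "i \<ge> 2" using l i by (cases i; cases "i - 1") auto
    then have "(p - 1) * 2 \<le> l" unfolding i by (rule mult_le_mono2)
    then have n2: "2 * p \<le> n + 2" using l by simp
    show ?thesis
    proof (cases "even n")
      case True
      then show ?thesis using n2 by (simp add: prime_bound_ge_iff)
    next
      case odd: False
      have "3 * p \<le> n + 2"
      proof (rule ccontr)
        assume less: "\<not> 3 * p \<le> n + 2"
        have "n + 2 \<noteq> 2 * p" using odd by (metis even_add even_mult_iff even_numeral)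
        with n2 have gt: "2 * p < n + 2" by simp
        have "\<not> p dvd Suc (Suc n)"
        proof
          assume "p dvd Suc (Suc n)"
          then obtain c where c: "Suc (Suc n) = p * c" ..
          have "p * 2 < p * c" "p * c < p * 3" using c gt less by linarith+
          then show False by simp
        qed
        then have "p dvd (Suc n choose (p - 1))"
          using prime_dvd_binomial_pred_iff[OF p] by simp
        \<comment> \<open>By parity \<open>n\<close> is strictly below \<open>3 * (p - 1)\<close>,
          so only the first two positive multiples of \<open>p - 1\<close> are in range.\<close>
        moreover have "n \<noteq> 3 * p - 3" using odd p3 by auto
        then have only: "h = p - 1 \<or> h = 2 * (p - 1)" if h: "0 < h" "h < Suc n" "(p - 1) dvd h" for h
        proof -
          obtain c where c: "h = (p - 1) * c" using h(3) ..
          have "(p - 1) * c < (p - 1) * 3"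
            using h c less \<open>n \<noteq> 3 * p - 3\<close> p3 by (simp add: algebra_simps)
          then have "c < 3" by simp
          moreover have "c \<noteq> 0" using h c by auto
          ultimately have "c = 1 \<or> c = 2" by auto
          then show ?thesis using c by auto
        qed
        ultimately have "k = 2 * (p - 1)" "k' = 2 * (p - 1)"
          using k k' by metis+
        then show False using k' by simp
      qed
      then show ?thesis using odd by (simp add: prime_bound_ge_iff)
    qed
  qed
qed

text \<open>For odd \<open>p\<close> not dividing \<open>n + 2\<close>, the index
  \<open>j = 1\<close> cannot be a witness, and of the two witnesses from Hermite's congruence one
  is not the top index \<open>?J\<close>; hence some witness lies in
  \<open>{2..?J - 1}\<close>.\<close>

lemma prime_exponent_eq:
  assumes p: "prime p" and le: "of_nat p \<le> prime_bound n"
  shows "prime_exponent n p = (if denom_prime (Suc n) p then 1 else 0)"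
proof (cases "p = 2")
  case True
  have "n = 2 ^ r - 1 \<longleftrightarrow> Suc n = 2 ^ r" for r :: nat
    by (cases "2 ^ r :: nat") auto
  then show ?thesis
    using True denom_prime_2_iff[of "Suc n"] by (simp add: prime_exponent_def)
next
  case False
  \<comment> \<open>This puts the index \<open>p - 1\<close> below \<open>Suc n\<close>, so that it
    can serve as a witness when \<open>p\<close> divides \<open>n + 2\<close>.\<close>
  have n2: "2 * p \<le> n + 2"
    using le by (auto simp: prime_bound_ge_iff split: if_splits)
  have p3: "p \<ge> 3" using p False prime_ge_2_nat[OF p] by auto
  let ?J = "n div (p - 1)"
  let ?E = "\<exists>j\<in>{2..?J - 1}. \<not> p dvd (n + 1 choose (j * (p - 1)))"
  have "denom_prime (Suc n) p \<longleftrightarrow> p dvd n + 2 \<or> ?E"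
  proof
    assume "p dvd n + 2 \<or> ?E"
    then show "denom_prime (Suc n) p"
    proof
      assume "p dvd n + 2"
      then have "\<not> p dvd (Suc n choose (p - 1))"
        using prime_dvd_binomial_pred_iff[OF p] by simp
      then show ?thesis using p3 n2
        by (intro denom_prime_odd_iff[OF p False, THEN iffD2] exI[of _ "p - 1"]) auto
    next
      assume ?E
      then obtain j where j: "j \<in> {2..?J - 1}" "\<not> p dvd (n + 1 choose (j * (p - 1)))" by blast
      then have "j * (p - 1) \<le> ?J * (p - 1)" by (intro mult_le_mono1) auto
      also have "\<dots> \<le> n" by (rule div_times_less_eq_dividend)
      finally show ?thesis using p3 j
        by (intro denom_prime_odd_iff[OF p False, THEN iffD2] exI[of _ "j * (p - 1)"]) auto
    qed
  next
    assume bad: "denom_prime (Suc n) p"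
    show "p dvd n + 2 \<or> ?E"
    proof (cases "p dvd n + 2")
      case False
      then have dvd: "p dvd (Suc n choose (p - 1))"
        using prime_dvd_binomial_pred_iff[OF p, of "Suc n"] by simp
      obtain k where k: "0 < k" "k < Suc n" "(p - 1) dvd k" "\<not> p dvd (Suc n choose k)"
        using bad denom_prime_odd_iff[OF p \<open>p \<noteq> 2\<close>] by auto
      obtain k' where k': "k' \<noteq> k" "0 < k'" "k' < Suc n" "(p - 1) dvd k'" "\<not> p dvd (Suc n choose k')"
        using exists_other_binomial_not_dvd[OF p k] .
      have "\<exists>k. k \<noteq> (p - 1) * ?J \<and> 0 < k \<and> k < Suc n \<and> (p - 1) dvd k \<and> \<not> p dvd (Suc n choose k)"
        using k k' by metis
      then obtain l where l: "l \<noteq> (p - 1) * ?J" "0 < l" "l < Suc n" "(p - 1) dvd l"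
          "\<not> p dvd (Suc n choose l)"
        by blast
      obtain j where j: "l = (p - 1) * j" using l(4) ..
      have "j \<le> ?J" using l j p3 by (simp add: less_eq_div_iff_mult_less_eq mult.commute)
      moreover have "j \<noteq> ?J" "j \<noteq> 0" "j \<noteq> 1" using l j dvd by auto
      ultimately have "j \<in> {2..?J - 1}" by auto
      then show ?thesis using l j by (intro disjI2 bexI[of _ j]) (auto simp: mult.commute)
    qed simp
  qed
  then show ?thesis using False by (auto simp: prime_exponent_def)
qed

section \<open>The denominator\<close>

text \<open>The leading coefficient \<open>1 / (n + 1)\<close> forces \<open>Suc n dvd d\<close>.
  The coefficients then become \<open>q\<close> times
  \<open>(Suc n choose k) * bernoulli_num k\<close>, and since \<open>p\<close> occurs at most once
  in their denominators, one factor \<open>p\<close> in \<open>q\<close> suffices.\<close>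

lemma smult_power_sum_poly_Ints_iff:
  "(\<forall>i. coeff (smult (of_nat d) (power_sum_poly n)) i \<in> \<int>) \<longleftrightarrow>
    (\<exists>q. d = Suc n * q \<and> (\<forall>p. denom_prime (Suc n) p \<longrightarrow> p dvd q))"
proof
  assume int: "\<forall>i. coeff (smult (of_nat d) (power_sum_poly n)) i \<in> \<int>"
  have lead: "of_nat (Suc n) * coeff (power_sum_poly n) (Suc n) = 1"
    using coeff_Suc_power_sum_poly'[of 0 n] by (simp add: bernoulli_num_0)
  obtain z where z: "of_nat d * coeff (power_sum_poly n) (Suc n) = of_int z"
    using int by (metis Ints_cases coeff_smult)
  have "of_int (int d) = (of_nat d * (of_nat (Suc n) * coeff (power_sum_poly n) (Suc n)) :: rat)"
    unfolding lead by simp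
  also have "\<dots> = of_int (int (Suc n) * z)"
    using z by (simp add: algebra_simps)
  finally have "int d = int (Suc n) * z" by (simp only: of_int_eq_iff)
  then have "Suc n dvd d" by (metis dvd_triv_left of_nat_dvd_iff)
  then obtain q where q: "d = Suc n * q" ..
  have "p dvd q" if "denom_prime (Suc n) p" for p
  proof (rule ccontr)
    assume ndvd: "\<not> p dvd q"
    obtain k where p: "prime p" and k: "k < Suc n"
        "of_nat (Suc n choose k) * bernoulli_num k \<notin> local_ints p"
      using \<open>denom_prime (Suc n) p\<close> unfolding denom_prime_def by blast
    have "q \<noteq> 0" using ndvd by (metis dvd_0_right)
    have "of_nat q * (of_nat (Suc n choose k) * bernoulli_num k) =
        coeff (smult (of_nat d) (power_sum_poly n)) (Suc n - k)"
      using k by (subst coeff_Suc_power_sum_poly'[symmetric]) (auto simp: q algebra_simps)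
    also have "\<dots> \<in> local_ints p"
      using int Ints_subset_local_ints[OF p] by blast
    finally have "inverse (of_nat q) * (of_nat q * (of_nat (Suc n choose k) * bernoulli_num k)) \<in> local_ints p"
      by (rule local_ints_mult[OF p inverse_of_nat_in_local_ints[OF ndvd]])
    with k \<open>q \<noteq> 0\<close> show False by (simp flip: mult.assoc)
  qed
  with q show "\<exists>q. d = Suc n * q \<and> (\<forall>p. denom_prime (Suc n) p \<longrightarrow> p dvd q)" by blast
next
  assume "\<exists>q. d = Suc n * q \<and> (\<forall>p. denom_prime (Suc n) p \<longrightarrow> p dvd q)"
  then obtain q where q: "d = Suc n * q" and dvd: "\<And>p. denom_prime (Suc n) p \<Longrightarrow> p dvd q" by blast
  show "\<forall>i. coeff (smult (of_nat d) (power_sum_poly n)) i \<in> \<int>"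
  proof
    fix i
    show "coeff (smult (of_nat d) (power_sum_poly n)) i \<in> \<int>"
    proof (cases "i = 0 \<or> i > Suc n")
      case True
      then show ?thesis by (simp add: coeff_power_sum_poly_eq_0)
    next
      case False
      define k where "k = Suc n - i"
      have k: "k < Suc n" "i = Suc n - k" using False by (auto simp: k_def)
      have eq: "coeff (smult (of_nat d) (power_sum_poly n)) i =
          of_nat q * (of_nat (Suc n choose k) * bernoulli_num k)"
        using k by (subst coeff_Suc_power_sum_poly'[symmetric]) (auto simp: q algebra_simps)
      show ?thesis unfolding eq Ints_iff_local_ints
      proof (intro allI impI)
        fix p :: nat assume p: "prime p"
        show "of_nat q * (of_nat (Suc n choose k) * bernoulli_num k) \<in> local_ints p"
        proof (cases "denom_prime (Suc n) p")
          case True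
          then obtain c where "q = p * c" using dvd by blast
          then have "of_nat q * (of_nat (Suc n choose k) * bernoulli_num k) =
              of_nat (c * (Suc n choose k)) * (of_nat p * bernoulli_num k)" by simp
          then show ?thesis
            by (simp only:) (intro local_ints_mult p local_ints_of_nat
              prime_times_bernoulli_num_in_local_ints)
        next
          case False
          then have "of_nat (Suc n choose k) * bernoulli_num k \<in> local_ints p"
            using p k by (auto simp: denom_prime_def)
          then show ?thesis by (rule local_ints_mult[OF p local_ints_of_nat[OF p]])
        qed
      qed
    qed
  qed
qed

lemma prod_primes_dvd:
  fixes q :: nat
  assumes "finite A" "\<And>p. p \<in> A \<Longrightarrow> prime p \<and> p dvd q"
  shows "\<Prod>A dvd q"
  using assms
proof (induction A rule: finite_induct)
  case (insert p A)
  have "coprime p (\<Prod>A)"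
    using insert by (intro prod_coprime_right) (metis insertCI primes_coprime)
  then show ?case using insert by (simp add: divides_mult)
qed simp

text \<open>The least positive \<open>q\<close> divisible by all these primes is their product.
  Finiteness matters because a product over an infinite set is 1 by convention;
  \<open>denom_prime_le_prime_bound\<close> supplies it.\<close>

lemma power_sum_denom_eq:
  assumes "finite {p. denom_prime (Suc n) p}"
  shows "power_sum_denom n = Suc n * \<Prod>{p. denom_prime (Suc n) p}"
  unfolding power_sum_denom_def smult_power_sum_poly_Ints_iff
proof (rule Least_equality)
  have "\<Prod>{p. denom_prime (Suc n) p} > 0"
    by (intro prod_pos) (auto simp: denom_prime_def prime_gt_0_nat)
  moreover have "p dvd \<Prod>{p. denom_prime (Suc n) p}" if "denom_prime (Suc n) p" for p
    using that assms by (intro dvd_prod_eqI[of _ p]) auto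
  ultimately show "0 < Suc n * \<Prod>{p. denom_prime (Suc n) p} \<and>
      (\<exists>q. Suc n * \<Prod>{p. denom_prime (Suc n) p} = Suc n * q \<and> (\<forall>p. denom_prime (Suc n) p \<longrightarrow> p dvd q))"
    by auto
next
  fix d assume "0 < d \<and> (\<exists>q. d = Suc n * q \<and> (\<forall>p. denom_prime (Suc n) p \<longrightarrow> p dvd q))"
  then obtain q where q: "d = Suc n * q" "q > 0" "\<And>p. denom_prime (Suc n) p \<Longrightarrow> p dvd q" by auto
  then have "\<Prod>{p. denom_prime (Suc n) p} dvd q"
    by (intro prod_primes_dvd assms) (auto simp: denom_prime_def)
  with q show "Suc n * \<Prod>{p. denom_prime (Suc n) p} \<le> d"
    by (simp only: mult_le_mono2 dvd_imp_le)
qed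

theorem theorem3:
  fixes n :: nat
  shows "power_sum_quot n =
    of_nat (\<Prod>p\<in>{p::nat. prime p \<and> of_nat p \<le> prime_bound n}. p ^ prime_exponent n p)"
proof -
  let ?A = "{p::nat. prime p \<and> of_nat p \<le> prime_bound n}" and ?B = "{p. denom_prime (Suc n) p}"
  have "?A \<subseteq> {..n + 2}" by (auto simp: prime_bound_ge_iff split: if_splits)
  then have finA: "finite ?A" by (rule finite_subset) simp
  have sub: "?B \<subseteq> ?A" using denom_prime_le_prime_bound by (auto simp: denom_prime_def)
  \<comment> \<open>Primes of \<open>?A\<close> outside \<open>?B\<close> have exponent 0 and
    contribute the factor 1.\<close>
  have "(\<Prod>p\<in>?A. p ^ prime_exponent n p) = (\<Prod>p\<in>?B. p)"
    using finA sub by (intro prod.mono_neutral_cong_right) (auto simp: prime_exponent_eq)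
  then show ?thesis
    using power_sum_denom_eq[OF finite_subset[OF sub finA]]
    by (simp add: power_sum_quot_def del: of_nat_Suc mult_Suc)
qed

end
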